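(* Let $F:\mathcal{C}\to\mathcal{D}$ and $G:\mathcal{D}\to\mathcal{C}$ be functors endowed with natural transformations $\eta:\mathrm{Id}_{\mathcal{C}}\to GF$ and $\epsilon:FG\to\mathrm{Id}_{\mathcal{D}}$. (1) If there is a natural transformation $\nu:GF\to\mathrm{Id}_{\mathcal{C}}$ such that $\nu\circ\eta=\mathrm{Id}$ and $\nu G=G\epsilon$, then $G$ is a coreflection up to retracts. (2) If there is a natural transformation $\gamma:\mathrm{Id}_{\mathcal{D}}\to FG$ such that $\epsilon\circ\gamma=\mathrm{Id}$ and $\gamma F=F\eta$, then $F$ is a reflection up to retracts.
   Context: The idempotent completion $\mathcal{C}^\natural$ of a category $\mathcal{C}$ has as objects the pairs $(X,e)$ with $X$ an object of $\mathcal{C}$ and $e:X\to X$ idempotent; a morphism $f:(X,e)\to(X',e')$ is a morphism $f:X\to X'$ in $\mathcal{C}$ with $f=e'\circ f\circ e$; composition is that of $\mathcal{C}$ and $\mathrm{Id}_{(X,e)}=e$. A functor $F:\mathcal{C}\to\mathcal{D}$ induces its completion $F^\natural:\mathcal{C}^\natural\to\mathcal{D}^\natural$, $F^\natural(X,e)=(FX,Fe)$, $F^\natural(f)=F(f)$. A reflection (resp. coreflection) is a functor admitting a fully faithful right (resp. left) adjoint. A functor $F$ is a reflection (resp. coreflection) up to retracts if $F^\natural$ is a reflection (resp. coreflection). Note that $F$ and $G$ are not assumed to be adjoint. *)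

theory Defs
  imports Main
begin

section \<open>Categories, functors and natural transformations\<close>

text \<open>An arrow determines its domain and codomain, so hom-sets are disjoint. Only the behaviour
  on \<open>Ob\<close> and \<open>Ar\<close> matters; the values of the operations elsewhere are junk.\<close>

record ('o, 'm) cat =
  Ob :: "'o set"
  Ar :: "'m set"
  Dom :: "'m \<Rightarrow> 'o"
  Cod :: "'m \<Rightarrow> 'o"
  Idn :: "'o \<Rightarrow> 'm"
  Comp :: "'m \<Rightarrow> 'm \<Rightarrow> 'm"  (infixl "\<cdot>\<index>" 55)

definition hom :: "('o, 'm) cat \<Rightarrow> 'o \<Rightarrow> 'o \<Rightarrow> 'm set" where
  "hom C X Y = {f \<in> Ar C. Dom C f = X \<and> Cod C f = Y}"

locale category =
  fixes C :: "('o, 'm) cat" (structure)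
  assumes Dom_Ob: "f \<in> Ar C \<Longrightarrow> Dom C f \<in> Ob C"
    and Cod_Ob: "f \<in> Ar C \<Longrightarrow> Cod C f \<in> Ob C"
    and Idn_hom: "X \<in> Ob C \<Longrightarrow> Idn C X \<in> hom C X X"
    and Comp_hom: "f \<in> hom C X Y \<Longrightarrow> g \<in> hom C Y Z \<Longrightarrow> g \<cdot> f \<in> hom C X Z"
    and Comp_Idn: "f \<in> hom C X Y \<Longrightarrow> f \<cdot> Idn C X = f"
    and Idn_Comp: "f \<in> hom C X Y \<Longrightarrow> Idn C Y \<cdot> f = f"
    and Comp_assoc: "f \<in> hom C X Y \<Longrightarrow> g \<in> hom C Y Z \<Longrightarrow> h \<in> hom C Z W \<Longrightarrow>
      h \<cdot> g \<cdot> f = h \<cdot> (g \<cdot> f)"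

record ('o1, 'm1, 'o2, 'm2) funct =
  FOb :: "'o1 \<Rightarrow> 'o2"
  FAr :: "'m1 \<Rightarrow> 'm2"

locale is_functor = C: category C + D: category D
  for C :: "('o1, 'm1) cat" and D :: "('o2, 'm2) cat"
    and F :: "('o1, 'm1, 'o2, 'm2) funct" +
  assumes FOb_Ob: "X \<in> Ob C \<Longrightarrow> FOb F X \<in> Ob D"
    and FAr_hom: "f \<in> hom C X Y \<Longrightarrow> FAr F f \<in> hom D (FOb F X) (FOb F Y)"
    and FAr_Idn: "X \<in> Ob C \<Longrightarrow> FAr F (Idn C X) = Idn D (FOb F X)"
    and FAr_Comp: "f \<in> hom C X Y \<Longrightarrow> g \<in> hom C Y Z \<Longrightarrow>
      FAr F (g \<cdot>\<^bsub>C\<^esub> f) = FAr F g \<cdot>\<^bsub>D\<^esub> FAr F f"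

definition id_funct :: "('o, 'm, 'o, 'm) funct" where
  "id_funct = \<lparr>FOb = (\<lambda>X. X), FAr = (\<lambda>f. f)\<rparr>"

definition comp_funct ::
  "('o2, 'm2, 'o3, 'm3) funct \<Rightarrow> ('o1, 'm1, 'o2, 'm2) funct \<Rightarrow> ('o1, 'm1, 'o3, 'm3) funct"
  (infixl "\<circ>\<^sub>F" 55) where
  "G \<circ>\<^sub>F F = \<lparr>FOb = (\<lambda>X. FOb G (FOb F X)), FAr = (\<lambda>f. FAr G (FAr F f))\<rparr>"

locale nat_trans = F: is_functor C D F + G: is_functor C D G
  for C :: "('o1, 'm1) cat" and D :: "('o2, 'm2) cat"
    and F G :: "('o1, 'm1, 'o2, 'm2) funct" and \<tau> :: "'o1 \<Rightarrow> 'm2" +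
  assumes component: "X \<in> Ob C \<Longrightarrow> \<tau> X \<in> hom D (FOb F X) (FOb G X)"
    and naturality: "f \<in> hom C X Y \<Longrightarrow> \<tau> Y \<cdot>\<^bsub>D\<^esub> FAr F f = FAr G f \<cdot>\<^bsub>D\<^esub> \<tau> X"

definition id_nat :: "('o2, 'm2) cat \<Rightarrow> ('o1, 'm1, 'o2, 'm2) funct \<Rightarrow> 'o1 \<Rightarrow> 'm2" where
  "id_nat D F = (\<lambda>X. Idn D (FOb F X))"

definition vcomp :: "('o2, 'm2) cat \<Rightarrow> ('o1 \<Rightarrow> 'm2) \<Rightarrow> ('o1 \<Rightarrow> 'm2) \<Rightarrow> 'o1 \<Rightarrow> 'm2" where
  "vcomp D \<tau> \<sigma> = (\<lambda>X. \<tau> X \<cdot>\<^bsub>D\<^esub> \<sigma> X)"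

text \<open>\<open>whisker_right \<tau> F\<close> is \<open>\<tau>F\<close> and \<open>whisker_left G \<tau>\<close> is \<open>G\<tau>\<close>.\<close>

definition whisker_right :: "('o2 \<Rightarrow> 'm3) \<Rightarrow> ('o1, 'm1, 'o2, 'm2) funct \<Rightarrow> 'o1 \<Rightarrow> 'm3" where
  "whisker_right \<tau> F = (\<lambda>X. \<tau> (FOb F X))"

definition whisker_left :: "('o2, 'm2, 'o3, 'm3) funct \<Rightarrow> ('o1 \<Rightarrow> 'm2) \<Rightarrow> 'o1 \<Rightarrow> 'm3" where
  "whisker_left G \<tau> = (\<lambda>X. FAr G (\<tau> X))"

text \<open>Equality of natural transformations of functors with source \<open>C\<close>; HOL equality would also
  compare the irrelevant values outside \<open>Ob C\<close>.\<close>

definition nat_eq :: "('o1, 'm1) cat \<Rightarrow> ('o1 \<Rightarrow> 'm2) \<Rightarrow> ('o1 \<Rightarrow> 'm2) \<Rightarrow> bool" where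
  "nat_eq C \<sigma> \<tau> \<longleftrightarrow> (\<forall>X\<in>Ob C. \<sigma> X = \<tau> X)"


section \<open>Adjunctions, reflections and coreflections\<close>

definition fully_faithful ::
  "('o1, 'm1) cat \<Rightarrow> ('o2, 'm2) cat \<Rightarrow> ('o1, 'm1, 'o2, 'm2) funct \<Rightarrow> bool" where
  "fully_faithful C D F \<longleftrightarrow> is_functor C D F \<and>
    (\<forall>X\<in>Ob C. \<forall>Y\<in>Ob C. bij_betw (FAr F) (hom C X Y) (hom D (FOb F X) (FOb F Y)))"

text \<open>\<open>adjoint C D L R\<close>: the functor \<open>L : C \<rightarrow> D\<close> is left adjoint to \<open>R : D \<rightarrow> C\<close>, by a unit and a
  counit satisfying the triangle identities.\<close>

definition adjoint ::
  "('o1, 'm1) cat \<Rightarrow> ('o2, 'm2) cat \<Rightarrow> ('o1, 'm1, 'o2, 'm2) funct \<Rightarrow>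
    ('o2, 'm2, 'o1, 'm1) funct \<Rightarrow> bool" where
  "adjoint C D L R \<longleftrightarrow> is_functor C D L \<and> is_functor D C R \<and>
    (\<exists>\<eta> \<epsilon>. nat_trans C C id_funct (R \<circ>\<^sub>F L) \<eta> \<and> nat_trans D D (L \<circ>\<^sub>F R) id_funct \<epsilon> \<and>
      nat_eq C (vcomp D (whisker_right \<epsilon> L) (whisker_left L \<eta>)) (id_nat D L) \<and>
      nat_eq D (vcomp C (whisker_left R \<epsilon>) (whisker_right \<eta> R)) (id_nat C R))"

definition reflection ::
  "('o1, 'm1) cat \<Rightarrow> ('o2, 'm2) cat \<Rightarrow> ('o1, 'm1, 'o2, 'm2) funct \<Rightarrow> bool" where
  "reflection C D F \<longleftrightarrow> (\<exists>R. adjoint C D F R \<and> fully_faithful D C R)"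

definition coreflection ::
  "('o1, 'm1) cat \<Rightarrow> ('o2, 'm2) cat \<Rightarrow> ('o1, 'm1, 'o2, 'm2) funct \<Rightarrow> bool" where
  "coreflection C D F \<longleftrightarrow> (\<exists>L. adjoint D C L F \<and> fully_faithful D C L)"


section \<open>Idempotent completion\<close>

definition completion_Ob :: "('o, 'm) cat \<Rightarrow> ('o \<times> 'm) set" where
  "completion_Ob C = {(X, e). X \<in> Ob C \<and> e \<in> hom C X X \<and> e \<cdot>\<^bsub>C\<^esub> e = e}"

text \<open>The same \<open>f\<close> may be a morphism between several pairs of objects of the completion, so an
  arrow \<open>f : (X, e) \<rightarrow> (X', e')\<close> is encoded as the triple \<open>((X, e), f, (X', e'))\<close>.\<close>

definition completion ::
  "('o, 'm) cat \<Rightarrow> ('o \<times> 'm, ('o \<times> 'm) \<times> 'm \<times> ('o \<times> 'm)) cat" where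
  "completion C = \<lparr>
    Ob = completion_Ob C,
    Ar = {((X, e), f, (X', e')) | X e f X' e'.
      (X, e) \<in> completion_Ob C \<and> (X', e') \<in> completion_Ob C \<and>
      f \<in> hom C X X' \<and> f = e' \<cdot>\<^bsub>C\<^esub> f \<cdot>\<^bsub>C\<^esub> e},
    Dom = (\<lambda>(p, f, q). p),
    Cod = (\<lambda>(p, f, q). q),
    Idn = (\<lambda>(X, e). ((X, e), e, (X, e))),
    Comp = (\<lambda>(q', g, r) (p, f, q). (p, g \<cdot>\<^bsub>C\<^esub> f, r))\<rparr>"

definition completion_funct ::
  "('o1, 'm1, 'o2, 'm2) funct \<Rightarrow>
    ('o1 \<times> 'm1, ('o1 \<times> 'm1) \<times> 'm1 \<times> ('o1 \<times> 'm1),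
     'o2 \<times> 'm2, ('o2 \<times> 'm2) \<times> 'm2 \<times> ('o2 \<times> 'm2)) funct" where
  "completion_funct F = \<lparr>
    FOb = (\<lambda>(X, e). (FOb F X, FAr F e)),
    FAr = (\<lambda>((X, e), f, (X', e')). ((FOb F X, FAr F e), FAr F f, (FOb F X', FAr F e')))\<rparr>"

definition reflection_up_to_retracts ::
  "('o1, 'm1) cat \<Rightarrow> ('o2, 'm2) cat \<Rightarrow> ('o1, 'm1, 'o2, 'm2) funct \<Rightarrow> bool" where
  "reflection_up_to_retracts C D F \<longleftrightarrow>
    is_functor C D F \<and> reflection (completion C) (completion D) (completion_funct F)"

definition coreflection_up_to_retracts ::
  "('o1, 'm1) cat \<Rightarrow> ('o2, 'm2) cat \<Rightarrow> ('o1, 'm1, 'o2, 'm2) funct \<Rightarrow> bool" where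
  "coreflection_up_to_retracts C D F \<longleftrightarrow>
    is_functor C D F \<and> coreflection (completion C) (completion D) (completion_funct F)"

lemma hom_completion:
  "hom (completion C) (X, e) (X', e') =
    {((X, e), f, (X', e')) | f. (X, e) \<in> completion_Ob C \<and> (X', e') \<in> completion_Ob C \<and>
      f \<in> hom C X X' \<and> f = e' \<cdot>\<^bsub>C\<^esub> f \<cdot>\<^bsub>C\<^esub> e}"
  by (auto simp: hom_def completion_def)

context category
begin

lemma hom_Ob: "f \<in> hom C X Y \<Longrightarrow> X \<in> Ob C \<and> Y \<in> Ob C"
  using Dom_Ob Cod_Ob by (auto simp: hom_def)

lemma idem_absorb:
  assumes "(X, e) \<in> completion_Ob C" "(X', e') \<in> completion_Ob C" "f \<in> hom C X X'"
  shows "f = e' \<cdot> f \<cdot> e \<longleftrightarrow> f \<cdot> e = f \<and> e' \<cdot> f = f"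
proof -
  have e: "e \<in> hom C X X" "e \<cdot> e = e" "e' \<in> hom C X' X'" "e' \<cdot> e' = e'"
    using assms by (auto simp: completion_Ob_def)
  have "e' \<cdot> f \<cdot> e \<cdot> e = e' \<cdot> f \<cdot> e"
    using e Comp_assoc[OF e(1) e(1) Comp_hom[OF assms(3) e(3)]] by simp
  moreover have "e' \<cdot> (e' \<cdot> f \<cdot> e) = e' \<cdot> f \<cdot> e"
    using e Comp_assoc[OF e(1) assms(3) e(3)] Comp_assoc[OF Comp_hom[OF e(1) assms(3)] e(3) e(3)]
    by simp
  ultimately show ?thesis by metis
qed

lemma category_completion: "category (completion C)"
proof
  fix p q r s
  show "Idn (completion C) p \<in> hom (completion C) p p" if "p \<in> Ob (completion C)"
  proof -
    obtain X e where "p = (X, e)" by (cases p)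
    with that show ?thesis
      by (auto simp: completion_def hom_def completion_Ob_def)
  qed
  fix f g h
  assume f: "f \<in> hom (completion C) p q"
  obtain X e Y d f' where [simp]: "p = (X, e)" "q = (Y, d)" "f = (p, f', q)"
    using f by (cases p; cases q) (auto simp: hom_completion)
  have f': "f' \<in> hom C X Y" "f' \<cdot> e = f'" "d \<cdot> f' = f'" "p \<in> completion_Ob C" "q \<in> completion_Ob C"
    using f idem_absorb[of X e Y d f'] by (auto simp: hom_completion)
  show "Comp (completion C) f (Idn (completion C) p) = f"
    "Comp (completion C) (Idn (completion C) q) f = f"
    using f' by (simp_all add: completion_def)
  assume g: "g \<in> hom (completion C) q r"
  obtain Z c g' where [simp]: "r = (Z, c)" "g = (q, g', r)"
    using g by (cases r) (auto simp: hom_completion)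
  have g': "g' \<in> hom C Y Z" "g' \<cdot> d = g'" "c \<cdot> g' = g'" "r \<in> completion_Ob C"
    using g idem_absorb[of Y d Z c g'] by (auto simp: hom_completion)
  have e: "e \<in> hom C X X" "c \<in> hom C Z Z" using f' g' by (auto simp: completion_Ob_def)
  have "g' \<cdot> f' \<cdot> e = g' \<cdot> f'" "c \<cdot> (g' \<cdot> f') = g' \<cdot> f'"
    using Comp_assoc[OF e(1) f'(1) g'(1)] Comp_assoc[OF f'(1) g'(1) e(2)] f' g' by auto
  then have "g' \<cdot> f' = c \<cdot> (g' \<cdot> f') \<cdot> e" by simp
  then show "Comp (completion C) g f \<in> hom (completion C) p r"
    using f' g' Comp_hom[OF f'(1) g'(1)] by (auto simp: hom_completion) (simp add: completion_def)
  fix h assume h: "h \<in> hom (completion C) r s"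
  obtain W b h' where [simp]: "s = (W, b)" "h = (r, h', s)"
    using h by (cases s) (auto simp: hom_completion)
  have "h' \<in> hom C Z W" using h by (auto simp: hom_completion)
  from Comp_assoc[OF f'(1) g'(1) this]
  show "Comp (completion C) (Comp (completion C) h g) f
    = Comp (completion C) h (Comp (completion C) g f)"
    by (simp add: completion_def)
qed (auto simp: completion_def)

end

lemma (in is_functor) is_functor_completion:
  "is_functor (completion C) (completion D) (completion_funct F)"
proof -
  interpret cC: category "completion C" by (rule C.category_completion)
  interpret cD: category "completion D" by (rule D.category_completion)
  have ob: "(FOb F X, FAr F e) \<in> completion_Ob D" if "(X, e) \<in> completion_Ob C" for X e
    using that FOb_Ob FAr_hom[of e X X] FAr_Comp[of e X X e X] by (auto simp: completion_Ob_def)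
  show ?thesis
  proof
    fix p q r
    show "FOb (completion_funct F) p \<in> Ob (completion D)" if "p \<in> Ob (completion C)"
      using that ob by (auto simp: completion_def completion_funct_def split: prod.splits)
    show "FAr (completion_funct F) (Idn (completion C) p)
      = Idn (completion D) (FOb (completion_funct F) p)"
      by (cases p) (simp add: completion_def completion_funct_def)
    fix f g assume f: "f \<in> hom (completion C) p q"
    obtain X e Y d f' where [simp]: "p = (X, e)" "q = (Y, d)" "f = (p, f', q)"
      using f by (cases p; cases q) (auto simp: hom_completion)
    have f': "f' \<in> hom C X Y" "f' = d \<cdot>\<^bsub>C\<^esub> f' \<cdot>\<^bsub>C\<^esub> e" "p \<in> completion_Ob C" "q \<in> completion_Ob C"
      using f by (auto simp: hom_completion)
    have e: "e \<in> hom C X X" "d \<in> hom C Y Y" using f' by (auto simp: completion_Ob_def)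
    have "FAr F f' = FAr F d \<cdot>\<^bsub>D\<^esub> FAr F f' \<cdot>\<^bsub>D\<^esub> FAr F e"
      using FAr_Comp[OF e(1) C.Comp_hom[OF f'(1) e(2)]] FAr_Comp[OF f'(1) e(2)] f'(2) by simp
    then show "FAr (completion_funct F) f
      \<in> hom (completion D) (FOb (completion_funct F) p) (FOb (completion_funct F) q)"
      using f' ob FAr_hom[OF f'(1)] by (simp add: completion_funct_def hom_completion)
    assume g: "g \<in> hom (completion C) q r"
    obtain Z c g' where [simp]: "r = (Z, c)" "g = (q, g', r)"
      using g by (cases r) (auto simp: hom_completion)
    have "g' \<in> hom C Y Z" using g by (auto simp: hom_completion)
    from FAr_Comp[OF f'(1) this]
    show "FAr (completion_funct F) (Comp (completion C) g f)
      = Comp (completion D) (FAr (completion_funct F) g) (FAr (completion_funct F) f)"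
      by (simp add: completion_def completion_funct_def)
  qed
qed

end

theory Submission
  imports Defs
begin

text \<open>In case (1) the endomorphism \<open>a = \<epsilon>F \<circ> F\<eta>\<close> of \<open>F\<close> satisfies \<open>Ga = \<eta> \<circ> \<nu>\<close>, which forces it to be
  idempotent. The assignment \<open>f \<mapsto> a \<circ> Ff\<close> is then a semifunctor (it preserves composition but not
  identities), and \<open>\<eta>\<close>, \<open>\<epsilon>\<close> satisfy the triangle identities between it and \<open>G\<close>, up to the images of
  identities. Semifunctors induce genuine functors between idempotent completions, and such a
  semi-adjunction induces a genuine adjunction, whose unit is invertible because of \<open>\<nu>\<close>. Case (2) is
  case (1) for the opposite categories; since completion commutes with opposites only up to
  isomorphism, the duality is applied to the semi-adjunctions rather than to the completions.\<close>

section \<open>Identity and composite functors\<close>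

lemma is_functor_id: "category C \<Longrightarrow> is_functor C C id_funct"
  by (simp add: is_functor_def is_functor_axioms_def id_funct_def)

lemma is_functor_comp:
  assumes "is_functor C D F" and "is_functor D E G"
  shows "is_functor C E (G \<circ>\<^sub>F F)"
proof -
  interpret F: is_functor C D F by fact
  interpret G: is_functor D E G by fact
  show ?thesis
    by unfold_locales (auto simp: comp_funct_def F.FAr_Idn F.FOb_Ob G.FAr_Idn F.FAr_Comp
        G.FAr_Comp[OF F.FAr_hom F.FAr_hom] intro: F.FOb_Ob G.FOb_Ob F.FAr_hom G.FAr_hom)
qed


section \<open>Opposite categories\<close>

text \<open>Objects and arrows keep their types, so the data of a functor or of a transformation is
  literally the same over the opposites. \<open>opp (opp C) = C\<close> is a true equality of
  records; it brings the dual case back at the very end.\<close>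

definition opp :: "('o, 'm) cat \<Rightarrow> ('o, 'm) cat" where
  "opp C = \<lparr>Ob = Ob C, Ar = Ar C, Dom = Cod C, Cod = Dom C, Idn = Idn C,
    Comp = (\<lambda>g f. f \<cdot>\<^bsub>C\<^esub> g)\<rparr>"

lemma opp_simps [simp]:
  "Ob (opp C) = Ob C" "Idn (opp C) = Idn C" "g \<cdot>\<^bsub>opp C\<^esub> f = f \<cdot>\<^bsub>C\<^esub> g"
  "hom (opp C) X Y = hom C Y X" "opp (opp C) = C"
  by (auto simp: opp_def hom_def)

lemma category_op:
  assumes "category C"
  shows "category (opp C)"
proof -
  interpret category C by fact
  show ?thesis
  proof
    show "Dom (opp C) f \<in> Ob (opp C)" "Cod (opp C) f \<in> Ob (opp C)" if "f \<in> Ar (opp C)" for f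
      using that Dom_Ob Cod_Ob by (simp_all add: opp_def)
  qed (auto intro: Idn_hom Comp_hom Comp_Idn Idn_Comp Comp_assoc[symmetric])
qed

lemma is_functor_op:
  assumes "is_functor C D F"
  shows "is_functor (opp C) (opp D) F"
proof -
  interpret is_functor C D F by fact
  show ?thesis
    by (intro is_functor.intro category_op C.category_axioms D.category_axioms
        is_functor_axioms.intro) (auto intro: FOb_Ob FAr_hom FAr_Idn FAr_Comp)
qed

lemma nat_trans_op:
  assumes "nat_trans C D F G \<tau>"
  shows "nat_trans (opp C) (opp D) G F \<tau>"
proof -
  interpret nat_trans C D F G \<tau> by fact
  show ?thesis
    by (intro nat_trans.intro is_functor_op F.is_functor_axioms G.is_functor_axioms
        nat_trans_axioms.intro) (auto intro: component naturality[symmetric])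
qed


section \<open>Semifunctors\<close>

text \<open>The record \<open>funct\<close> is shared with functors, so
  \<open>completion_funct\<close> applies unchanged to a semifunctor. The image of an identity is an
  idempotent.\<close>

locale semifunctor = C: category C + D: category D
  for C :: "('o1, 'm1) cat" and D :: "('o2, 'm2) cat"
    and F :: "('o1, 'm1, 'o2, 'm2) funct" +
  assumes FOb_Ob: "X \<in> Ob C \<Longrightarrow> FOb F X \<in> Ob D"
    and FAr_hom: "f \<in> hom C X Y \<Longrightarrow> FAr F f \<in> hom D (FOb F X) (FOb F Y)"
    and FAr_Comp: "f \<in> hom C X Y \<Longrightarrow> g \<in> hom C Y Z \<Longrightarrow>
      FAr F (g \<cdot>\<^bsub>C\<^esub> f) = FAr F g \<cdot>\<^bsub>D\<^esub> FAr F f"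

sublocale is_functor \<subseteq> semifunctor
  by unfold_locales (auto intro: FOb_Ob FAr_hom FAr_Comp)

lemma semifunctor_op:
  assumes "semifunctor C D F"
  shows "semifunctor (opp C) (opp D) F"
proof -
  interpret semifunctor C D F by fact
  show ?thesis
    by (intro semifunctor.intro category_op C.category_axioms D.category_axioms
        semifunctor_axioms.intro) (auto intro: FOb_Ob FAr_hom FAr_Comp)
qed

text \<open>Through \<open>idem_absorb\<close> the single equation f = d f e is traded for
  absorption on each side separately, the form in which all later computations use it.\<close>

lemma (in category) completion_homE:
  assumes "f \<in> hom (completion C) p q"
  obtains X e Y d f' where "p = (X, e)" "q = (Y, d)" "f = (p, f', q)" "f' \<in> hom C X Y"
    "f' \<cdot> e = f'" "d \<cdot> f' = f'" "p \<in> completion_Ob C" "q \<in> completion_Ob C"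
    "e \<in> hom C X X" "d \<in> hom C Y Y"
proof -
  obtain X e Y d f' where *: "p = (X, e)" "q = (Y, d)" "f = (p, f', q)"
    using assms by (cases p; cases q) (auto simp: hom_completion)
  then show thesis
    using that[of X e Y d f'] assms idem_absorb[of X e Y d f']
    by (auto simp: hom_completion completion_Ob_def)
qed

lemma (in category) completion_homI:
  assumes "(X, e) \<in> completion_Ob C" "(Y, d) \<in> completion_Ob C" "f \<in> hom C X Y"
    "f \<cdot> e = f" "d \<cdot> f = f"
  shows "((X, e), f, (Y, d)) \<in> hom (completion C) (X, e) (Y, d)"
  using assms by (simp add: hom_completion)

lemma completion_simps [simp]:
  "Ob (completion C) = completion_Ob C" "Idn (completion C) (X, e) = ((X, e), e, (X, e))"
  "(q', g, r) \<cdot>\<^bsub>completion C\<^esub> (p, f, q) = (p, g \<cdot>\<^bsub>C\<^esub> f, r)"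
  by (simp_all add: completion_def)

lemma completion_funct_simps [simp]:
  "FOb (completion_funct F) (X, e) = (FOb F X, FAr F e)"
  "FAr (completion_funct F) (p, f, q)
    = (FOb (completion_funct F) p, FAr F f, FOb (completion_funct F) q)"
  by (simp_all add: completion_funct_def split: prod.splits)

context semifunctor
begin

lemma completion_Ob_image:
  "(X, e) \<in> completion_Ob C \<Longrightarrow> (FOb F X, FAr F e) \<in> completion_Ob D"
  using FOb_Ob FAr_hom[of e X X] FAr_Comp[of e X X e X] by (auto simp: completion_Ob_def)

text \<open>The identity of (X, e) is carried by e and that of its image by F e. Identities are thus
  preserved by construction, whatever F does to the identities of C.\<close>

lemma is_functor_completion_funct:
  "is_functor (completion C) (completion D) (completion_funct F)"
proof (intro is_functor.intro C.category_completion D.category_completion is_functor_axioms.intro)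
  fix p q r
  show "FOb (completion_funct F) p \<in> Ob (completion D)" if "p \<in> Ob (completion C)"
    using that completion_Ob_image by (cases p) simp
  show "FAr (completion_funct F) (Idn (completion C) p)
    = Idn (completion D) (FOb (completion_funct F) p)"
    by (cases p) simp
  fix f g assume f: "f \<in> hom (completion C) p q"
  from f show "FAr (completion_funct F) f
      \<in> hom (completion D) (FOb (completion_funct F) p) (FOb (completion_funct F) q)"
  proof (rule C.completion_homE)
    fix X e Y d f' assume f': "p = (X, e)" "q = (Y, d)" "f = (p, f', q)" "f' \<in> hom C X Y"
      "f' \<cdot>\<^bsub>C\<^esub> e = f'" "d \<cdot>\<^bsub>C\<^esub> f' = f'" "p \<in> completion_Ob C" "q \<in> completion_Ob C"
      "e \<in> hom C X X" "d \<in> hom C Y Y"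
    then show ?thesis
      using FAr_Comp[OF \<open>e \<in> _\<close> \<open>f' \<in> _\<close>] FAr_Comp[OF \<open>f' \<in> _\<close> \<open>d \<in> _\<close>]
      by (auto intro!: D.completion_homI completion_Ob_image FAr_hom)
  qed
  assume "g \<in> hom (completion C) q r"
  with f show "FAr (completion_funct F) (Comp (completion C) g f)
    = Comp (completion D) (FAr (completion_funct F) g) (FAr (completion_funct F) f)"
    by (auto elim!: C.completion_homE simp: FAr_Comp)
qed

end

text \<open>The full faithfulness of the functor that a semifunctor induces on completions, restricted to
  the objects \<open>(X, Id)\<close>, whose images are the \<open>(F X, F Id)\<close>.\<close>

definition semi_fully_faithful ::
  "('o1, 'm1) cat \<Rightarrow> ('o2, 'm2) cat \<Rightarrow> ('o1, 'm1, 'o2, 'm2) funct \<Rightarrow> bool" where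
  "semi_fully_faithful C D F \<longleftrightarrow> (\<forall>X\<in>Ob C. \<forall>Y\<in>Ob C. bij_betw (FAr F) (hom C X Y)
    {g \<in> hom D (FOb F X) (FOb F Y). g \<cdot>\<^bsub>D\<^esub> FAr F (Idn C X) = g \<and> FAr F (Idn C Y) \<cdot>\<^bsub>D\<^esub> g = g})"

lemma semi_fully_faithful_op:
  "semi_fully_faithful C D F \<Longrightarrow> semi_fully_faithful (opp C) (opp D) F"
  by (simp add: semi_fully_faithful_def conj_commute)

text \<open>A morphism g between the images of (X, e) and (Y, d) absorbs F e and F d. Since these
  absorb F Id, so does g, and the assumed bijection supplies a preimage f of g in C.\<close>

lemma (in semifunctor) fully_faithful_completion_funct:
  assumes ff: "semi_fully_faithful C D F"
  shows "fully_faithful (completion C) (completion D) (completion_funct F)"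
  unfolding fully_faithful_def
proof (intro conjI ballI is_functor_completion_funct)
  fix p q assume p: "p \<in> Ob (completion C)" and q: "q \<in> Ob (completion C)"
  obtain X e Y d where [simp]: "p = (X, e)" "q = (Y, d)" by (cases p; cases q)
  have e: "X \<in> Ob C" "e \<in> hom C X X" and d: "Y \<in> Ob C" "d \<in> hom C Y Y"
    using p q by (auto simp: completion_Ob_def)
  let ?S = "{g \<in> hom D (FOb F X) (FOb F Y). g \<cdot>\<^bsub>D\<^esub> FAr F (Idn C X) = g \<and> FAr F (Idn C Y) \<cdot>\<^bsub>D\<^esub> g = g}"
  have bij: "bij_betw (FAr F) (hom C X Y) ?S"
    using ff e d by (auto simp: semi_fully_faithful_def)
  have inj: "f = f'" if "f \<in> hom C X Y" "f' \<in> hom C X Y" "FAr F f = FAr F f'" for f f'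
    using bij that by (auto simp: bij_betw_def inj_on_def)
  interpret cF: is_functor "completion C" "completion D" "completion_funct F"
    by (rule is_functor_completion_funct)
  show "bij_betw (FAr (completion_funct F)) (hom (completion C) p q)
    (hom (completion D) (FOb (completion_funct F) p) (FOb (completion_funct F) q))"
  proof (rule bij_betw_imageI)
    show "inj_on (FAr (completion_funct F)) (hom (completion C) p q)"
      by (auto simp: inj_on_def hom_completion intro: inj)
    have "k \<in> FAr (completion_funct F) ` hom (completion C) p q"
      if cod: "k \<in> hom (completion D) (FOb (completion_funct F) p) (FOb (completion_funct F) q)" for k
    proof -
      obtain g where k: "k = ((FOb F X, FAr F e), g, (FOb F Y, FAr F d))"
        and g: "g \<in> hom D (FOb F X) (FOb F Y)" "g \<cdot>\<^bsub>D\<^esub> FAr F e = g" "FAr F d \<cdot>\<^bsub>D\<^esub> g = g"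
        by (rule D.completion_homE[OF cod]) auto
      have "FAr F e \<cdot>\<^bsub>D\<^esub> FAr F (Idn C X) = FAr F e"
        using FAr_Comp[OF C.Idn_hom e(2)] e C.Comp_Idn by simp
      then have "g \<cdot>\<^bsub>D\<^esub> FAr F (Idn C X) = g"
        using D.Comp_assoc[OF FAr_hom[OF C.Idn_hom] FAr_hom g(1)] e g(2) by metis
      moreover have "FAr F (Idn C Y) \<cdot>\<^bsub>D\<^esub> FAr F d = FAr F d"
        using FAr_Comp[OF d(2) C.Idn_hom] d C.Idn_Comp by simp
      then have "FAr F (Idn C Y) \<cdot>\<^bsub>D\<^esub> g = g"
        using D.Comp_assoc[OF g(1) FAr_hom FAr_hom[OF C.Idn_hom]] d g(3) by metis
      ultimately have "g \<in> ?S" using g by simp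
      then obtain f where f: "f \<in> hom C X Y" "g = FAr F f"
        using bij by (auto simp: bij_betw_def)
      \<comment> \<open>Injectivity forces f to be a morphism of the completion: f e and f have the
        same image g, and likewise d f and f.\<close>
      have "f \<cdot>\<^bsub>C\<^esub> e = f" "d \<cdot>\<^bsub>C\<^esub> f = f"
        using g FAr_Comp[OF e(2) f(1)] FAr_Comp[OF f(1) d(2)] f e d
        by (auto intro!: inj C.Comp_hom)
      then have "(p, f, q) \<in> hom (completion C) p q"
        using p q f by (auto intro: C.completion_homI)
      then show ?thesis using k f by force
    qed
    then show "FAr (completion_funct F) ` hom (completion C) p q
      = hom (completion D) (FOb (completion_funct F) p) (FOb (completion_funct F) q)"
      using cF.FAr_hom by blast
  qed
qed


section \<open>Semi-adjunctions\<close>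

text \<open>Both \<open>L\<close> and \<open>R\<close> are semifunctors, which makes the notion
  self-dual. In case (1) the right one is a genuine functor, in case (2) the left one.\<close>

locale semi_adjunction = L: semifunctor C D L + R: semifunctor D C R
  for C :: "('o1, 'm1) cat" and D :: "('o2, 'm2) cat"
    and L :: "('o1, 'm1, 'o2, 'm2) funct" and R :: "('o2, 'm2, 'o1, 'm1) funct"
    and \<eta> :: "'o1 \<Rightarrow> 'm1" and \<epsilon> :: "'o2 \<Rightarrow> 'm2" +
  assumes unit_hom: "X \<in> Ob C \<Longrightarrow> \<eta> X \<in> hom C X (FOb R (FOb L X))"
    and counit_hom: "U \<in> Ob D \<Longrightarrow> \<epsilon> U \<in> hom D (FOb L (FOb R U)) U"
    and unit_natural: "f \<in> hom C X Y \<Longrightarrow> FAr R (FAr L f) \<cdot>\<^bsub>C\<^esub> \<eta> X = \<eta> Y \<cdot>\<^bsub>C\<^esub> f"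
    and counit_natural: "g \<in> hom D U V \<Longrightarrow> \<epsilon> V \<cdot>\<^bsub>D\<^esub> FAr L (FAr R g) = g \<cdot>\<^bsub>D\<^esub> \<epsilon> U"
    and triangle_left: "X \<in> Ob C \<Longrightarrow> \<epsilon> (FOb L X) \<cdot>\<^bsub>D\<^esub> FAr L (\<eta> X) = FAr L (Idn C X)"
    and triangle_right: "U \<in> Ob D \<Longrightarrow> FAr R (\<epsilon> U) \<cdot>\<^bsub>C\<^esub> \<eta> (FOb R U) = FAr R (Idn D U)"

lemma semi_adjunction_op:
  assumes "semi_adjunction C D L R \<eta> \<epsilon>"
  shows "semi_adjunction (opp D) (opp C) R L \<epsilon> \<eta>"
proof -
  interpret semi_adjunction C D L R \<eta> \<epsilon> by fact
  show ?thesis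
    by (intro semi_adjunction.intro semifunctor_op L.semifunctor_axioms R.semifunctor_axioms
        semi_adjunction_axioms.intro)
      (auto intro: unit_hom counit_hom unit_natural counit_natural triangle_left triangle_right)
qed

context semi_adjunction
begin

lemma adjoint_completion:
  "adjoint (completion C) (completion D) (completion_funct L) (completion_funct R)"
proof -
  let ?C = "completion C" and ?D = "completion D"
  let ?L = "completion_funct L" and ?R = "completion_funct R"
  interpret cC: category ?C by (rule L.C.category_completion)
  interpret cD: category ?D by (rule L.D.category_completion)
  interpret cL: is_functor ?C ?D ?L by (rule L.is_functor_completion_funct)
  interpret cR: is_functor ?D ?C ?R by (rule R.is_functor_completion_funct)
  \<comment> \<open>The components of \<eta> and \<epsilon> are cut down by the idempotents.
    Absorption on the side of the cut is idempotency; on the other side it follows from naturality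
    of \<eta> and \<epsilon> at e and d.\<close>
  define u where "u = (\<lambda>(X, e). ((X, e), \<eta> X \<cdot>\<^bsub>C\<^esub> e, FOb ?R (FOb ?L (X, e))))"
  define c where "c = (\<lambda>(Y, d). (FOb ?L (FOb ?R (Y, d)), d \<cdot>\<^bsub>D\<^esub> \<epsilon> Y, (Y, d)))"
  have "nat_trans ?C ?C id_funct (?R \<circ>\<^sub>F ?L) u"
  proof (intro nat_trans.intro nat_trans_axioms.intro is_functor_id cC.category_axioms
      is_functor_comp[OF cL.is_functor_axioms cR.is_functor_axioms])
    fix p assume p: "p \<in> Ob ?C"
    obtain X e where [simp]: "p = (X, e)" by (cases p)
    have e: "X \<in> Ob C" "e \<in> hom C X X" "e \<cdot>\<^bsub>C\<^esub> e = e" using p by (auto simp: completion_Ob_def)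
    note h = unit_hom[OF e(1)] R.FAr_hom[OF L.FAr_hom[OF e(2)]]
    have "\<eta> X \<cdot>\<^bsub>C\<^esub> e \<cdot>\<^bsub>C\<^esub> e = \<eta> X \<cdot>\<^bsub>C\<^esub> e" using L.C.Comp_assoc[OF e(2) e(2) h(1)] e by simp
    moreover have "FAr R (FAr L e) \<cdot>\<^bsub>C\<^esub> (\<eta> X \<cdot>\<^bsub>C\<^esub> e) = \<eta> X \<cdot>\<^bsub>C\<^esub> e"
      using L.C.Comp_assoc[OF e(2) h(1,2)] unit_natural[OF e(2)] calculation by simp
    ultimately show "u p \<in> hom ?C (FOb id_funct p) (FOb (?R \<circ>\<^sub>F ?L) p)"
      using p L.C.Comp_hom[OF e(2) h(1)]
      by (auto simp: u_def id_funct_def comp_funct_def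
          intro!: L.C.completion_homI R.completion_Ob_image L.completion_Ob_image)
  next
    fix k p q assume "k \<in> hom ?C p q"
    then show "u q \<cdot>\<^bsub>?C\<^esub> FAr id_funct k = FAr (?R \<circ>\<^sub>F ?L) k \<cdot>\<^bsub>?C\<^esub> u p"
    proof (rule L.C.completion_homE)
      fix X e Y d f assume f: "p = (X, e)" "q = (Y, d)" "k = (p, f, q)" "f \<in> hom C X Y"
        "f \<cdot>\<^bsub>C\<^esub> e = f" "d \<cdot>\<^bsub>C\<^esub> f = f" "p \<in> completion_Ob C" "q \<in> completion_Ob C"
        "e \<in> hom C X X" "d \<in> hom C Y Y"
      have X: "X \<in> Ob C" "Y \<in> Ob C" using f L.C.hom_Ob by auto
      show ?thesis
        using f L.C.Comp_assoc[OF f(4) f(10) unit_hom[OF X(2)]]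
          L.C.Comp_assoc[OF f(9) unit_hom[OF X(1)] R.FAr_hom[OF L.FAr_hom[OF f(4)]]]
          L.C.Comp_assoc[OF f(9) f(4) unit_hom[OF X(2)]] unit_natural[OF f(4)]
        by (simp add: u_def id_funct_def comp_funct_def)
    qed
  qed
  moreover have "nat_trans ?D ?D (?L \<circ>\<^sub>F ?R) id_funct c"
  proof (intro nat_trans.intro nat_trans_axioms.intro is_functor_id cD.category_axioms
      is_functor_comp[OF cR.is_functor_axioms cL.is_functor_axioms])
    fix p assume p: "p \<in> Ob ?D"
    obtain Y d where [simp]: "p = (Y, d)" by (cases p)
    have d: "Y \<in> Ob D" "d \<in> hom D Y Y" "d \<cdot>\<^bsub>D\<^esub> d = d" using p by (auto simp: completion_Ob_def)
    note h = counit_hom[OF d(1)] L.FAr_hom[OF R.FAr_hom[OF d(2)]]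
    have "d \<cdot>\<^bsub>D\<^esub> (d \<cdot>\<^bsub>D\<^esub> \<epsilon> Y) = d \<cdot>\<^bsub>D\<^esub> \<epsilon> Y" using L.D.Comp_assoc[OF h(1) d(2) d(2)] d by simp
    moreover have "d \<cdot>\<^bsub>D\<^esub> \<epsilon> Y \<cdot>\<^bsub>D\<^esub> FAr L (FAr R d) = d \<cdot>\<^bsub>D\<^esub> \<epsilon> Y"
      using L.D.Comp_assoc[OF h(2,1) d(2)] counit_natural[OF d(2)] calculation by simp
    ultimately show "c p \<in> hom ?D (FOb (?L \<circ>\<^sub>F ?R) p) (FOb id_funct p)"
      using p L.D.Comp_hom[OF h(1) d(2)]
      by (auto simp: c_def id_funct_def comp_funct_def
          intro!: L.D.completion_homI R.completion_Ob_image L.completion_Ob_image)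
  next
    fix k p q assume "k \<in> hom ?D p q"
    then show "c q \<cdot>\<^bsub>?D\<^esub> FAr (?L \<circ>\<^sub>F ?R) k = FAr id_funct k \<cdot>\<^bsub>?D\<^esub> c p"
    proof (rule L.D.completion_homE)
      fix X e Y d g assume g: "p = (X, e)" "q = (Y, d)" "k = (p, g, q)" "g \<in> hom D X Y"
        "g \<cdot>\<^bsub>D\<^esub> e = g" "d \<cdot>\<^bsub>D\<^esub> g = g" "p \<in> completion_Ob D" "q \<in> completion_Ob D"
        "e \<in> hom D X X" "d \<in> hom D Y Y"
      have X: "X \<in> Ob D" "Y \<in> Ob D" using g L.D.hom_Ob by auto
      show ?thesis
        using g L.D.Comp_assoc[OF counit_hom[OF X(1)] g(9) g(4)]
          L.D.Comp_assoc[OF L.FAr_hom[OF R.FAr_hom[OF g(4)]] counit_hom[OF X(2)] g(10)]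
          L.D.Comp_assoc[OF counit_hom[OF X(1)] g(4) g(10)] counit_natural[OF g(4)]
        by (simp add: c_def id_funct_def comp_funct_def)
    qed
  qed
  moreover have
    "nat_eq ?C (vcomp ?D (whisker_right c ?L) (whisker_left ?L u)) (id_nat ?D ?L)"
    unfolding nat_eq_def
  proof
    fix p assume "p \<in> Ob ?C"
    then obtain X e where p: "p = (X, e)" and e: "X \<in> Ob C" "e \<in> hom C X X" "e \<cdot>\<^bsub>C\<^esub> e = e"
      by (auto simp: completion_Ob_def)
    note h = L.FAr_hom[OF e(2)] L.FAr_hom[OF unit_hom[OF e(1)]] counit_hom[OF L.FOb_Ob[OF e(1)]]
    \<comment> \<open>The triangle identity leaves L Id between two copies of L e. There it
      disappears, and the product is L e, the identity of the image of (X, e).\<close>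
    have "FAr L e \<cdot>\<^bsub>D\<^esub> \<epsilon> (FOb L X) \<cdot>\<^bsub>D\<^esub> FAr L (\<eta> X \<cdot>\<^bsub>C\<^esub> e)
        = FAr L e \<cdot>\<^bsub>D\<^esub> (\<epsilon> (FOb L X) \<cdot>\<^bsub>D\<^esub> FAr L (\<eta> X) \<cdot>\<^bsub>D\<^esub> FAr L e)"
      using L.D.Comp_assoc[OF L.D.Comp_hom[OF h(1,2)] h(3) h(1)] L.D.Comp_assoc[OF h(1,2,3)]
        L.FAr_Comp[OF e(2) unit_hom[OF e(1)]] by simp
    also have "\<dots> = FAr L e"
      using triangle_left[OF e(1)] L.FAr_Comp[OF e(2) L.C.Idn_hom[OF e(1)]]
        L.C.Idn_Comp[OF e(2)] L.FAr_Comp[OF e(2) e(2)] e(3) by simp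
    finally show "vcomp ?D (whisker_right c ?L) (whisker_left ?L u) p = id_nat ?D ?L p"
      by (simp add: p vcomp_def whisker_right_def whisker_left_def id_nat_def u_def c_def)
  qed
  moreover have
    "nat_eq ?D (vcomp ?C (whisker_left ?R c) (whisker_right u ?R)) (id_nat ?C ?R)"
    unfolding nat_eq_def
  proof
    fix p assume "p \<in> Ob ?D"
    then obtain Y d where p: "p = (Y, d)" and d: "Y \<in> Ob D" "d \<in> hom D Y Y" "d \<cdot>\<^bsub>D\<^esub> d = d"
      by (auto simp: completion_Ob_def)
    note h = R.FAr_hom[OF d(2)] unit_hom[OF R.FOb_Ob[OF d(1)]] R.FAr_hom[OF counit_hom[OF d(1)]]
    have "FAr R (d \<cdot>\<^bsub>D\<^esub> \<epsilon> Y) \<cdot>\<^bsub>C\<^esub> (\<eta> (FOb R Y) \<cdot>\<^bsub>C\<^esub> FAr R d)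
        = FAr R d \<cdot>\<^bsub>C\<^esub> (FAr R (\<epsilon> Y) \<cdot>\<^bsub>C\<^esub> \<eta> (FOb R Y) \<cdot>\<^bsub>C\<^esub> FAr R d)"
      using L.C.Comp_assoc[OF L.C.Comp_hom[OF h(1,2)] h(3) h(1)] L.C.Comp_assoc[OF h(1,2,3)]
        R.FAr_Comp[OF counit_hom[OF d(1)] d(2)] by simp
    also have "\<dots> = FAr R d"
      using triangle_right[OF d(1)] R.FAr_Comp[OF d(2) L.D.Idn_hom[OF d(1)]]
        L.D.Idn_Comp[OF d(2)] R.FAr_Comp[OF d(2) d(2)] d(3) by simp
    finally show "vcomp ?C (whisker_left ?R c) (whisker_right u ?R) p = id_nat ?C ?R p"
      by (simp add: p vcomp_def whisker_right_def whisker_left_def id_nat_def u_def c_def)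
  qed
  ultimately show ?thesis
    unfolding adjoint_def using cL.is_functor_axioms cR.is_functor_axioms by blast
qed

text \<open>This is the semi version of the fact that a left adjoint is fully faithful when the unit
  is invertible: the hypotheses say that \<open>r X\<close> inverts \<eta> X as a morphism from (X,
  Id) to (R L X, R L Id) in the completion.\<close>

lemma semi_fully_faithful_left:
  assumes "\<And>X. X \<in> Ob C \<Longrightarrow> r X \<in> hom C (FOb R (FOb L X)) X"
    and "\<And>X. X \<in> Ob C \<Longrightarrow> r X \<cdot>\<^bsub>C\<^esub> \<eta> X = Idn C X"
    and "\<And>X. X \<in> Ob C \<Longrightarrow> \<eta> X \<cdot>\<^bsub>C\<^esub> r X = FAr R (FAr L (Idn C X))"
  shows "semi_fully_faithful C D L"
  unfolding semi_fully_faithful_def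
proof (intro ballI)
  fix X Y assume X: "X \<in> Ob C" and Y: "Y \<in> Ob C"
  note \<eta>X = unit_hom[OF X] and \<eta>Y = unit_hom[OF Y] and rY = assms(1)[OF Y]
  let ?S = "{g \<in> hom D (FOb L X) (FOb L Y). g \<cdot>\<^bsub>D\<^esub> FAr L (Idn C X) = g \<and> FAr L (Idn C Y) \<cdot>\<^bsub>D\<^esub> g = g}"
  show "bij_betw (FAr L) (hom C X Y) ?S"
  proof (rule bij_betw_imageI)
    show "inj_on (FAr L) (hom C X Y)"
    proof (rule inj_onI)
      fix f f' assume f: "f \<in> hom C X Y" "f' \<in> hom C X Y" and "FAr L f = FAr L f'"
      \<comment> \<open>By naturality \<eta> Y \<circ> f depends only on L f, and \<eta> Y has the
        left inverse \<open>r Y\<close>.\<close>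
      then have "\<eta> Y \<cdot>\<^bsub>C\<^esub> f = \<eta> Y \<cdot>\<^bsub>C\<^esub> f'"
        using unit_natural[OF f(1)] unit_natural[OF f(2)] by simp
      then have "r Y \<cdot>\<^bsub>C\<^esub> \<eta> Y \<cdot>\<^bsub>C\<^esub> f = r Y \<cdot>\<^bsub>C\<^esub> \<eta> Y \<cdot>\<^bsub>C\<^esub> f'"
        using L.C.Comp_assoc[OF f(1) \<eta>Y rY] L.C.Comp_assoc[OF f(2) \<eta>Y rY] by simp
      then show "f = f'"
        using f assms(2)[OF Y] by (simp add: L.C.Idn_Comp)
    qed
    have "FAr L f \<in> ?S" if "f \<in> hom C X Y" for f
      using that L.FAr_hom[OF that] L.FAr_Comp[OF L.C.Idn_hom[OF X] that]
        L.FAr_Comp[OF that L.C.Idn_hom[OF Y]] by (simp add: L.C.Comp_Idn L.C.Idn_Comp)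
    moreover have "g \<in> FAr L ` hom C X Y" if "g \<in> ?S" for g
    proof -
      have g: "g \<in> hom D (FOb L X) (FOb L Y)" "g \<cdot>\<^bsub>D\<^esub> FAr L (Idn C X) = g"
        "FAr L (Idn C Y) \<cdot>\<^bsub>D\<^esub> g = g" using that by auto
      note Rg = R.FAr_hom[OF g(1)]
      \<comment> \<open>The preimage of g is its transpose R g \<circ> \<eta> X : X \<rightarrow> R
        L Y, brought back to Y by \<open>r Y\<close>.\<close>
      define f where "f = r Y \<cdot>\<^bsub>C\<^esub> (FAr R g \<cdot>\<^bsub>C\<^esub> \<eta> X)"
      have f: "f \<in> hom C X Y"
        unfolding f_def by (intro L.C.Comp_hom[OF L.C.Comp_hom[OF \<eta>X Rg] rY])
      \<comment> \<open>A morphism that absorbs L Id on its source is recovered from its transpose.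
        Hence g = L f follows once both have the same transpose.\<close>
      have transpose: "k = \<epsilon> (FOb L Y) \<cdot>\<^bsub>D\<^esub> FAr L (FAr R k \<cdot>\<^bsub>C\<^esub> \<eta> X)"
        if k: "k \<in> hom D (FOb L X) (FOb L Y)" "k \<cdot>\<^bsub>D\<^esub> FAr L (Idn C X) = k" for k
      proof -
        note h = L.FAr_hom[OF \<eta>X] L.FAr_hom[OF R.FAr_hom[OF k(1)]]
          counit_hom[OF L.FOb_Ob[OF Y]] counit_hom[OF L.FOb_Ob[OF X]]
        have "\<epsilon> (FOb L Y) \<cdot>\<^bsub>D\<^esub> FAr L (FAr R k \<cdot>\<^bsub>C\<^esub> \<eta> X)
            = \<epsilon> (FOb L Y) \<cdot>\<^bsub>D\<^esub> FAr L (FAr R k) \<cdot>\<^bsub>D\<^esub> FAr L (\<eta> X)"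
          using L.FAr_Comp[OF \<eta>X R.FAr_hom[OF k(1)]] L.D.Comp_assoc[OF h(1,2,3)] by simp
        also have "\<dots> = k \<cdot>\<^bsub>D\<^esub> (\<epsilon> (FOb L X) \<cdot>\<^bsub>D\<^esub> FAr L (\<eta> X))"
          using counit_natural[OF k(1)] L.D.Comp_assoc[OF h(1,4) k(1)] by simp
        finally show ?thesis using triangle_left[OF X] k(2) by simp
      qed
      have "FAr R (FAr L f) \<cdot>\<^bsub>C\<^esub> \<eta> X = \<eta> Y \<cdot>\<^bsub>C\<^esub> r Y \<cdot>\<^bsub>C\<^esub> (FAr R g \<cdot>\<^bsub>C\<^esub> \<eta> X)"
        using unit_natural[OF f] L.C.Comp_assoc[OF L.C.Comp_hom[OF \<eta>X Rg] rY \<eta>Y]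
        by (simp add: f_def)
      also have "\<dots> = FAr R g \<cdot>\<^bsub>C\<^esub> \<eta> X"
        using assms(3)[OF Y] L.C.Comp_assoc[OF \<eta>X Rg R.FAr_hom[OF L.FAr_hom[OF L.C.Idn_hom[OF Y]]]]
          R.FAr_Comp[OF g(1) L.FAr_hom[OF L.C.Idn_hom[OF Y]]] g(3) by simp
      finally have "g = FAr L f"
        using transpose[OF g(1,2)] transpose[OF L.FAr_hom[OF f]]
          L.FAr_Comp[OF L.C.Idn_hom[OF X] f] L.C.Comp_Idn[OF f] by simp
      then show ?thesis using f by blast
    qed
    ultimately show "FAr L ` hom C X Y = ?S" by blast
  qed
qed

lemma coreflection_completion:
  assumes "semi_fully_faithful C D L"
  shows "coreflection (completion D) (completion C) (completion_funct R)"
  unfolding coreflection_def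
  using adjoint_completion L.fully_faithful_completion_funct[OF assms] by blast

lemma reflection_completion:
  assumes "semi_fully_faithful D C R"
  shows "reflection (completion C) (completion D) (completion_funct L)"
  unfolding reflection_def
  using adjoint_completion R.fully_faithful_completion_funct[OF assms] by blast

end

section \<open>From a retraction of the unit to a semi-adjunction\<close>

lemma semi_adjunction_of_unit_retraction:
  assumes "is_functor C D F" and "is_functor D C G"
    and "nat_trans C C id_funct (G \<circ>\<^sub>F F) \<eta>" and "nat_trans D D (F \<circ>\<^sub>F G) id_funct \<epsilon>"
    and "nat_trans C C (G \<circ>\<^sub>F F) id_funct \<nu>"
    and "nat_eq C (vcomp C \<nu> \<eta>) (id_nat C id_funct)"
    and "nat_eq D (whisker_right \<nu> G) (whisker_left G \<epsilon>)"
  obtains L where "semi_adjunction C D L G \<eta> \<epsilon>" "semi_fully_faithful C D L"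
proof -
  interpret F: is_functor C D F by fact
  interpret G: is_functor D C G by fact
  have \<eta>: "\<eta> X \<in> hom C X (FOb G (FOb F X))" if "X \<in> Ob C" for X
    using nat_trans.component[OF assms(3) that] by (simp add: id_funct_def comp_funct_def)
  have \<eta>_nat: "\<eta> Y \<cdot>\<^bsub>C\<^esub> f = FAr G (FAr F f) \<cdot>\<^bsub>C\<^esub> \<eta> X" if "f \<in> hom C X Y" for f X Y
    using nat_trans.naturality[OF assms(3) that] by (simp add: id_funct_def comp_funct_def)
  have \<epsilon>: "\<epsilon> Y \<in> hom D (FOb F (FOb G Y)) Y" if "Y \<in> Ob D" for Y
    using nat_trans.component[OF assms(4) that] by (simp add: id_funct_def comp_funct_def)
  have \<epsilon>_nat: "\<epsilon> Y \<cdot>\<^bsub>D\<^esub> FAr F (FAr G g) = g \<cdot>\<^bsub>D\<^esub> \<epsilon> X" if "g \<in> hom D X Y" for g X Y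
    using nat_trans.naturality[OF assms(4) that] by (simp add: id_funct_def comp_funct_def)
  have \<nu>: "\<nu> X \<in> hom C (FOb G (FOb F X)) X" if "X \<in> Ob C" for X
    using nat_trans.component[OF assms(5) that] by (simp add: id_funct_def comp_funct_def)
  have \<nu>_nat: "\<nu> Y \<cdot>\<^bsub>C\<^esub> FAr G (FAr F f) = f \<cdot>\<^bsub>C\<^esub> \<nu> X" if "f \<in> hom C X Y" for f X Y
    using nat_trans.naturality[OF assms(5) that] by (simp add: id_funct_def comp_funct_def)
  have \<nu>\<eta>: "\<nu> X \<cdot>\<^bsub>C\<^esub> \<eta> X = Idn C X" if "X \<in> Ob C" for X
    using assms(6) that by (simp add: nat_eq_def vcomp_def id_nat_def id_funct_def)
  have \<nu>G: "\<nu> (FOb G Y) = FAr G (\<epsilon> Y)" if "Y \<in> Ob D" for Y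
    using assms(7) that by (simp add: nat_eq_def whisker_left_def whisker_right_def)

  \<comment> \<open>In an adjunction between F and G this would be the identity, by a triangle
    identity. Here only the other triangle is available: G\<epsilon> \<circ> \<eta>G = \<nu>G
    \<circ> \<eta>G = Id.\<close>
  define a where "a = (\<lambda>X. \<epsilon> (FOb F X) \<cdot>\<^bsub>D\<^esub> FAr F (\<eta> X))"
  have a: "a X \<in> hom D (FOb F X) (FOb F X)" if "X \<in> Ob C" for X
    unfolding a_def by (rule F.D.Comp_hom[OF F.FAr_hom[OF \<eta>[OF that]] \<epsilon>[OF F.FOb_Ob[OF that]]])
  have a_nat: "a Y \<cdot>\<^bsub>D\<^esub> FAr F f = FAr F f \<cdot>\<^bsub>D\<^esub> a X" if f: "f \<in> hom C X Y" for f X Y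
  proof -
    have X: "X \<in> Ob C" "Y \<in> Ob C" using F.C.hom_Ob[OF f] by auto
    note h = F.FAr_hom[OF f] F.FAr_hom[OF \<eta>[OF X(1)]] F.FAr_hom[OF \<eta>[OF X(2)]]
      \<epsilon>[OF F.FOb_Ob[OF X(1)]] \<epsilon>[OF F.FOb_Ob[OF X(2)]]
      F.FAr_hom[OF G.FAr_hom[OF F.FAr_hom[OF f]]]
    have "a Y \<cdot>\<^bsub>D\<^esub> FAr F f = \<epsilon> (FOb F Y) \<cdot>\<^bsub>D\<^esub> FAr F (\<eta> Y \<cdot>\<^bsub>C\<^esub> f)"
      using F.D.Comp_assoc[OF h(1,3,5)] F.FAr_Comp[OF f \<eta>[OF X(2)]] by (simp add: a_def)
    also have "\<dots> = \<epsilon> (FOb F Y) \<cdot>\<^bsub>D\<^esub> FAr F (FAr G (FAr F f)) \<cdot>\<^bsub>D\<^esub> FAr F (\<eta> X)"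
      using F.D.Comp_assoc[OF h(2,6,5)] \<eta>_nat[OF f]
        F.FAr_Comp[OF \<eta>[OF X(1)] G.FAr_hom[OF F.FAr_hom[OF f]]] by simp
    also have "\<dots> = FAr F f \<cdot>\<^bsub>D\<^esub> a X"
      using F.D.Comp_assoc[OF h(2,4,1)] \<epsilon>_nat[OF h(1)] by (simp add: a_def)
    finally show ?thesis .
  qed
  \<comment> \<open>G a is G\<epsilon>F \<circ> GF\<eta>, and G\<epsilon>F is \<nu>GF; naturality of
    \<nu> at the morphism \<eta> X then turns \<nu> \<circ> GF\<eta> into \<eta> \<circ>
    \<nu>.\<close>
  have Ga: "FAr G (a X) = \<eta> X \<cdot>\<^bsub>C\<^esub> \<nu> X" if X: "X \<in> Ob C" for X
    using G.FAr_Comp[OF F.FAr_hom[OF \<eta>[OF X]] \<epsilon>[OF F.FOb_Ob[OF X]]] \<nu>_nat[OF \<eta>[OF X]]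
      \<nu>G[OF F.FOb_Ob[OF X]] by (simp add: a_def)
  have Ga_\<eta>: "FAr G (a X) \<cdot>\<^bsub>C\<^esub> \<eta> X = \<eta> X" if X: "X \<in> Ob C" for X
    using F.C.Comp_assoc[OF \<eta>[OF X] \<nu>[OF X] \<eta>[OF X]] Ga[OF X] \<nu>\<eta>[OF X] F.C.Comp_Idn[OF \<eta>[OF X]]
    by simp
  \<comment> \<open>Naturality of \<epsilon> at k shows that k \<circ> a depends only on G k \<circ>
    \<eta> X. For k = a this transpose is \<eta> X, giving idempotency; for k = \<epsilon> Y it is
    the identity, so \<epsilon> absorbs a.\<close>
  have slide: "k \<cdot>\<^bsub>D\<^esub> a X = \<epsilon> Y \<cdot>\<^bsub>D\<^esub> FAr F (FAr G k \<cdot>\<^bsub>C\<^esub> \<eta> X)"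
    if X: "X \<in> Ob C" and k: "k \<in> hom D (FOb F X) Y" for k X Y
    using F.D.Comp_assoc[OF F.FAr_hom[OF \<eta>[OF X]] \<epsilon>[OF F.FOb_Ob[OF X]] k] \<epsilon>_nat[OF k]
      F.FAr_Comp[OF \<eta>[OF X] G.FAr_hom[OF k]] F.D.hom_Ob[OF k]
      F.D.Comp_assoc[OF F.FAr_hom[OF \<eta>[OF X]] F.FAr_hom[OF G.FAr_hom[OF k]] \<epsilon>]
    by (simp add: a_def)
  have a_idem: "a X \<cdot>\<^bsub>D\<^esub> a X = a X" if X: "X \<in> Ob C" for X
    using slide[OF X a[OF X]] Ga_\<eta>[OF X] by (simp add: a_def)
  have \<epsilon>_a: "\<epsilon> Y \<cdot>\<^bsub>D\<^esub> a (FOb G Y) = \<epsilon> Y" if Y: "Y \<in> Ob D" for Y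
    using slide[OF G.FOb_Ob[OF Y] \<epsilon>[OF Y]] \<nu>G[OF Y] \<nu>\<eta>[OF G.FOb_Ob[OF Y]]
      F.FAr_Idn[OF G.FOb_Ob[OF Y]] F.D.Comp_Idn[OF \<epsilon>[OF Y]] by simp

  \<comment> \<open>Taking a at the codomain is a mere choice: by \<open>a_nat\<close> it could
    equally be composed on the source side.\<close>
  define L where "L = \<lparr>FOb = FOb F, FAr = (\<lambda>f. a (Cod C f) \<cdot>\<^bsub>D\<^esub> FAr F f)\<rparr>"
  have LOb [simp]: "FOb L X = FOb F X" for X by (simp add: L_def)
  have LAr: "FAr L f = a Y \<cdot>\<^bsub>D\<^esub> FAr F f" if "f \<in> hom C X Y" for f X Y
    using that by (simp add: L_def hom_def)
  have L_Idn: "FAr L (Idn C X) = a X" if X: "X \<in> Ob C" for X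
    using LAr[OF F.C.Idn_hom[OF X]] F.FAr_Idn[OF X] F.D.Comp_Idn[OF a[OF X]] by simp
  interpret L: semifunctor C D L
  proof
    show "FOb L X \<in> Ob D" if "X \<in> Ob C" for X using F.FOb_Ob[OF that] by simp
    fix f X Y assume f: "f \<in> hom C X Y"
    then have Y: "Y \<in> Ob C" using F.C.hom_Ob by blast
    show "FAr L f \<in> hom D (FOb L X) (FOb L Y)"
      using F.D.Comp_hom[OF F.FAr_hom[OF f] a[OF Y]] LAr[OF f] by simp
    fix g Z assume g: "g \<in> hom C Y Z"
    then have Z: "Z \<in> Ob C" using F.C.hom_Ob by blast
    note h = F.FAr_hom[OF f] F.FAr_hom[OF g] a[OF Y] a[OF Z]
    \<comment> \<open>The copy of a in the middle of L g \<circ> L f is moved past F g by naturality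
      and merged with the other copy by idempotency.\<close>
    have "a Z \<cdot>\<^bsub>D\<^esub> FAr F g \<cdot>\<^bsub>D\<^esub> a Y = a Z \<cdot>\<^bsub>D\<^esub> FAr F g"
      using a_nat[OF g] F.D.Comp_assoc[OF h(3,3,2)] a_idem[OF Y] by simp
    then show "FAr L (g \<cdot>\<^bsub>C\<^esub> f) = FAr L g \<cdot>\<^bsub>D\<^esub> FAr L f"
      using LAr[OF f] LAr[OF g] LAr[OF F.C.Comp_hom[OF f g]] F.FAr_Comp[OF f g]
        F.D.Comp_assoc[OF h(1,2,4)] F.D.Comp_assoc[OF h(1,3) F.D.Comp_hom[OF h(2,4)]] by simp
  qed
  interpret semi_adjunction C D L G \<eta> \<epsilon>
  proof
    fix X assume X: "X \<in> Ob C"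
    show "\<eta> X \<in> hom C X (FOb G (FOb L X))" using \<eta>[OF X] by simp
    have GF: "FOb G (FOb F X) \<in> Ob C" by (intro G.FOb_Ob F.FOb_Ob X)
    show "\<epsilon> (FOb L X) \<cdot>\<^bsub>D\<^esub> FAr L (\<eta> X) = FAr L (Idn C X)"
      using LAr[OF \<eta>[OF X]] L_Idn[OF X] \<epsilon>_a[OF F.FOb_Ob[OF X]]
        F.D.Comp_assoc[OF F.FAr_hom[OF \<eta>[OF X]] a[OF GF] \<epsilon>[OF F.FOb_Ob[OF X]]]
      by (simp add: a_def)
  next
    fix Y assume Y: "Y \<in> Ob D"
    show "\<epsilon> Y \<in> hom D (FOb L (FOb G Y)) Y" using \<epsilon>[OF Y] by simp
    show "FAr G (\<epsilon> Y) \<cdot>\<^bsub>C\<^esub> \<eta> (FOb G Y) = FAr G (Idn D Y)"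
      using \<nu>G[OF Y] \<nu>\<eta>[OF G.FOb_Ob[OF Y]] G.FAr_Idn[OF Y] by simp
  next
    fix f X Y assume f: "f \<in> hom C X Y"
    then have X: "X \<in> Ob C" "Y \<in> Ob C" using F.C.hom_Ob by auto
    note h = \<eta>[OF X(1)] G.FAr_hom[OF F.FAr_hom[OF f]] G.FAr_hom[OF a[OF X(2)]]
    show "FAr G (FAr L f) \<cdot>\<^bsub>C\<^esub> \<eta> X = \<eta> Y \<cdot>\<^bsub>C\<^esub> f"
      using LAr[OF f] G.FAr_Comp[OF F.FAr_hom[OF f] a[OF X(2)]] F.C.Comp_assoc[OF h]
        \<eta>_nat[OF f] F.C.Comp_assoc[OF f \<eta>[OF X(2)] h(3)] Ga_\<eta>[OF X(2)] by simp
  next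
    fix g Y Z assume g: "g \<in> hom D Y Z"
    then have Z: "Z \<in> Ob D" using F.D.hom_Ob by blast
    show "\<epsilon> Z \<cdot>\<^bsub>D\<^esub> FAr L (FAr G g) = g \<cdot>\<^bsub>D\<^esub> \<epsilon> Y"
      using LAr[OF G.FAr_hom[OF g]] \<epsilon>_nat[OF g] \<epsilon>_a[OF Z]
        F.D.Comp_assoc[OF F.FAr_hom[OF G.FAr_hom[OF g]] a[OF G.FOb_Ob[OF Z]] \<epsilon>[OF Z]] by simp
  qed
  \<comment> \<open>The inverse of the unit is \<nu>: one composite is the hypothesis on \<nu>
    \<circ> \<eta>, and the other is \<open>Ga\<close>, because L Id = a.\<close>
  have "semi_fully_faithful C D L"
    by (rule semi_fully_faithful_left[of \<nu>]) (use \<nu> \<nu>\<eta> Ga L_Idn in auto)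
  then show thesis using that semi_adjunction_axioms by blast
qed

section \<open>The two cases of the theorem\<close>

theorem proposition2p20:
  fixes C :: "('o1, 'm1) cat" and D :: "('o2, 'm2) cat"
    and F :: "('o1, 'm1, 'o2, 'm2) funct" and G :: "('o2, 'm2, 'o1, 'm1) funct"
    and \<eta> :: "'o1 \<Rightarrow> 'm1" and \<epsilon> :: "'o2 \<Rightarrow> 'm2"
  assumes "category C" and "category D"
    and "is_functor C D F" and "is_functor D C G"
    and "nat_trans C C id_funct (G \<circ>\<^sub>F F) \<eta>"
    and "nat_trans D D (F \<circ>\<^sub>F G) id_funct \<epsilon>"
  shows "((\<exists>\<nu>. nat_trans C C (G \<circ>\<^sub>F F) id_funct \<nu> \<and>
            nat_eq C (vcomp C \<nu> \<eta>) (id_nat C id_funct) \<and>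
            nat_eq D (whisker_right \<nu> G) (whisker_left G \<epsilon>))
          \<longrightarrow> coreflection_up_to_retracts D C G) \<and>
         ((\<exists>\<gamma>. nat_trans D D id_funct (F \<circ>\<^sub>F G) \<gamma> \<and>
            nat_eq D (vcomp D \<epsilon> \<gamma>) (id_nat D id_funct) \<and>
            nat_eq C (whisker_right \<gamma> F) (whisker_left F \<eta>))
          \<longrightarrow> reflection_up_to_retracts C D F)"
proof (intro conjI impI; elim exE conjE)
  fix \<nu>
  assume "nat_trans C C (G \<circ>\<^sub>F F) id_funct \<nu>" "nat_eq C (vcomp C \<nu> \<eta>) (id_nat C id_funct)"
    "nat_eq D (whisker_right \<nu> G) (whisker_left G \<epsilon>)"
  from semi_adjunction_of_unit_retraction[OF assms(3-6) this]
  obtain L where "semi_adjunction C D L G \<eta> \<epsilon>" "semi_fully_faithful C D L" .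
  then show "coreflection_up_to_retracts D C G"
    unfolding coreflection_up_to_retracts_def
    using assms(4) semi_adjunction.coreflection_completion by blast
next
  fix \<gamma>
  assume \<gamma>: "nat_trans D D id_funct (F \<circ>\<^sub>F G) \<gamma>" "nat_eq D (vcomp D \<epsilon> \<gamma>) (id_nat D id_funct)"
    "nat_eq C (whisker_right \<gamma> F) (whisker_left F \<eta>)"
  \<comment> \<open>With arrows reversed, F and G exchange roles: \<epsilon> becomes the
    transformation from the identity to FG, \<eta> the one from GF to the identity, and \<gamma>
    takes the place of \<nu>.\<close>
  have "nat_eq (opp D) (vcomp (opp D) \<gamma> \<epsilon>) (id_nat (opp D) id_funct)"
    "nat_eq (opp C) (whisker_right \<gamma> F) (whisker_left F \<eta>)"
    using \<gamma>(2,3) by (simp_all add: nat_eq_def vcomp_def id_nat_def)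
  from semi_adjunction_of_unit_retraction[OF is_functor_op[OF assms(4)] is_functor_op[OF assms(3)]
      nat_trans_op[OF assms(6)] nat_trans_op[OF assms(5)] nat_trans_op[OF \<gamma>(1)] this]
  obtain R where R: "semi_adjunction (opp D) (opp C) R F \<epsilon> \<eta>"
    "semi_fully_faithful (opp D) (opp C) R" .
  \<comment> \<open>The second dualization makes \<open>R\<close> a right semi-adjoint of F, and
    only now are completions taken, directly over C and D.\<close>
  have "semi_adjunction C D F R \<eta> \<epsilon>" "semi_fully_faithful D C R"
    using semi_adjunction_op[OF R(1)] semi_fully_faithful_op[OF R(2)] by simp_all
  then show "reflection_up_to_retracts C D F"
    unfolding reflection_up_to_retracts_def
    using assms(3) semi_adjunction.reflection_completion by blast
qed

end
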